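(* Let $S=\{n_1,n_2,\ldots,n_s\}$ be a set of integers with $2\le n_s<\cdots<n_2<n_1$. Then the mixed hypergraph $\mathcal H^{\star}_{n_1,\ldots,n_s}=(X_{n_1,\ldots,n_s},\mathcal C^{\star}_{n_1,\ldots,n_s},\mathcal D_{n_1,\ldots,n_s})$, which has $2n_1-2n_s$ $\mathcal C$-edges, is a one-realization of $S$.
   Context: A mixed hypergraph is a triple $\mathcal H=(X,\mathcal C,\mathcal D)$ where $X$ is a finite set and $\mathcal C,\mathcal D$ are families of subsets of $X$ ($\mathcal C$-edges and $\mathcal D$-edges). A proper $k$-coloring is a map from $X$ to a set of $k$ colors such that every $\mathcal C$-edge contains two vertices of a common color and every $\mathcal D$-edge contains two vertices of distinct colors; it is strict if all $k$ colors are used. Colorings are identified with partitions of $X$ into color classes. The feasible set is the set of $k$ for which a strict $k$-coloring exists; $r_k$ is the number of partitions arising as strict $k$-colorings. $\mathcal H$ is a one-realization of $S$ if its feasible set is $S$ and $r_k=1$ for all $k\in S$. Notation: $[m]=\{1,\ldots,m\}$. Vertices are $s$-tuples of integers. For $t\in\{2,\ldots,s\}$ and an integer $j$, let $u_t(j)=(j,\ldots,j,n_t,n_{t+1},\ldots,n_s)$ and $v_t(j)=(j,\ldots,j,1,\ldots,1)$, where in both $j$ is repeated $t-1$ times. Define $X_{n_1,\ldots,n_s}=\{(n_1,\ldots,n_s)\}\cup\{(i,\ldots,i): i\in[n_s-1]\}\cup\{u_t(j),v_t(j): 2\le t\le s,\ n_t\le j\le n_{t-1}-1\}$; $\mathcal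 D_{n_1,\ldots,n_s}$ = all pairs $\{(x_1,\ldots,x_s),(y_1,\ldots,y_s)\}$ of elements of $X_{n_1,\ldots,n_s}$ with $x_i\ne y_i$ for every $i\in[s]$; $\mathcal C^{\star}_{n_1,\ldots,n_s}$ consists of, for each $t\in\{2,\ldots,s\}$: the triples $\{u_t(j),v_t(j),v_t(j-1)\}$ for $n_t+1\le j\le n_{t-1}-1$; the triples $\{v_t(j),u_t(j),u_t(j+1)\}$ for $n_t\le j\le n_{t-1}-1$; and the triple $\{u_t(n_t),v_t(n_t),(1,\ldots,1)\}$. (Note $u_t(n_{t-1})$ is the vertex $(n_{t-1},\ldots,n_{t-1},n_t,\ldots,n_s)$ of $X_{n_1,\ldots,n_s}$, which for $t=2$ is $(n_1,\ldots,n_s)$.) *)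

theory Defs
  imports Main "HOL-Library.FuncSet"
begin

record 'v mixed_hypergraph =
  vertices :: "'v set"
  c_edges :: "'v set set"
  d_edges :: "'v set set"

definition is_mixed_hypergraph :: "'v mixed_hypergraph \<Rightarrow> bool" where
  "is_mixed_hypergraph H \<longleftrightarrow>
     finite (vertices H) \<and> c_edges H \<subseteq> Pow (vertices H) \<and> d_edges H \<subseteq> Pow (vertices H)"

(* The k colors are fixed to be 1, ..., k; the colorings are total functions, of which only
   the values on the vertices matter. *)
definition proper_coloring :: "'v mixed_hypergraph \<Rightarrow> nat \<Rightarrow> ('v \<Rightarrow> nat) \<Rightarrow> bool" where
  "proper_coloring H k c \<longleftrightarrow>
     c \<in> vertices H \<rightarrow> {1..k} \<and>
     (\<forall>e\<in>c_edges H. \<exists>x\<in>e. \<exists>y\<in>e. x \<noteq> y \<and> c x = c y) \<and>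
     (\<forall>e\<in>d_edges H. \<exists>x\<in>e. \<exists>y\<in>e. c x \<noteq> c y)"

definition strict_coloring :: "'v mixed_hypergraph \<Rightarrow> nat \<Rightarrow> ('v \<Rightarrow> nat) \<Rightarrow> bool" where
  "strict_coloring H k c \<longleftrightarrow> proper_coloring H k c \<and> c ` vertices H = {1..k}"

definition color_classes :: "'v mixed_hypergraph \<Rightarrow> ('v \<Rightarrow> nat) \<Rightarrow> 'v set set" where
  "color_classes H c = {{x \<in> vertices H. c x = i} | i. i \<in> c ` vertices H}"

definition feasible_set :: "'v mixed_hypergraph \<Rightarrow> nat set" where
  "feasible_set H = {k. \<exists>c. strict_coloring H k c}"

definition num_strict_partitions :: "'v mixed_hypergraph \<Rightarrow> nat \<Rightarrow> nat" where
  "num_strict_partitions H k = card {color_classes H c | c. strict_coloring H k c}"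

definition one_realization :: "'v mixed_hypergraph \<Rightarrow> nat set \<Rightarrow> bool" where
  "one_realization H S \<longleftrightarrow>
     is_mixed_hypergraph H \<and> feasible_set H = S \<and> (\<forall>k\<in>S. num_strict_partitions H k = 1)"

(* The sequence n_1, ..., n_s is a function n, of which only the values n 1, ..., n s are used.
   An s-tuple is a list of length s; list positions count from 0. *)

definition u_vert :: "nat \<Rightarrow> (nat \<Rightarrow> nat) \<Rightarrow> nat \<Rightarrow> nat \<Rightarrow> nat list" where
  "u_vert s n t j = replicate (t - 1) j @ map n [t..<s + 1]"

definition v_vert :: "nat \<Rightarrow> nat \<Rightarrow> nat \<Rightarrow> nat list" where
  "v_vert s t j = replicate (t - 1) j @ replicate (s + 1 - t) 1"

definition X_set :: "nat \<Rightarrow> (nat \<Rightarrow> nat) \<Rightarrow> nat list set" where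
  "X_set s n =
     {map n [1..<s + 1]} \<union> {replicate s i | i. i \<in> {1..n s - 1}} \<union>
     (\<Union>t\<in>{2..s}. \<Union>j\<in>{n t..n (t - 1) - 1}. {u_vert s n t j, v_vert s t j})"

definition D_set :: "nat \<Rightarrow> (nat \<Rightarrow> nat) \<Rightarrow> nat list set set" where
  "D_set s n = {{x, y} | x y. x \<in> X_set s n \<and> y \<in> X_set s n \<and> (\<forall>i<s. x ! i \<noteq> y ! i)}"

definition C_star :: "nat \<Rightarrow> (nat \<Rightarrow> nat) \<Rightarrow> nat list set set" where
  "C_star s n = (\<Union>t\<in>{2..s}.
     {{u_vert s n t j, v_vert s t j, v_vert s t (j - 1)} | j. j \<in> {n t + 1..n (t - 1) - 1}} \<union>
     {{v_vert s t j, u_vert s n t j, u_vert s n t (j + 1)} | j. j \<in> {n t..n (t - 1) - 1}} \<union>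
     {{u_vert s n t (n t), v_vert s t (n t), replicate s 1}})"

definition H_star :: "nat \<Rightarrow> (nat \<Rightarrow> nat) \<Rightarrow> nat list mixed_hypergraph" where
  "H_star s n = \<lparr>vertices = X_set s n, c_edges = C_star s n, d_edges = D_set s n\<rparr>"

end

theory Submission
  imports Defs
begin

text \<open>
  All vertices fit into two families indexed by a single integer \<open>j \<in> {1..n 1}\<close>: \<open>U j\<close> with
  coordinates \<open>min j (n p)\<close> and \<open>V j\<close> with coordinates \<open>j\<close> where \<open>j < n p\<close> and \<open>1\<close> elsewhere.
  The vertices \<open>V j\<close> and \<open>U k\<close> form a \<open>\<D>\<close>-edge whenever \<open>j \<noteq> k\<close> and \<open>2 \<le> k\<close>, and the
  \<open>\<C>\<close>-edges become \<open>{V j, U j, U (j + 1)}\<close> and \<open>{U j, V j, W}\<close> for \<open>n s \<le> j < n 1\<close>, where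
  \<open>W\<close> is \<open>V 1\<close> if \<open>j\<close> is some \<open>n t\<close> and \<open>V (j - 1)\<close> otherwise.

  Given a proper coloring, let \<open>m\<close> be the least \<open>j\<close> such that \<open>U j\<close> and \<open>V j\<close> have distinct
  colors. The second kind of \<open>\<C>\<close>-edge forces \<open>m = n i\<close> for some \<open>i\<close>; from \<open>m\<close> on, the
  \<open>\<C>\<close>-edges force all \<open>V j\<close> to have the color of \<open>V 1\<close> and all \<open>U j\<close> the color of \<open>U m\<close>.
  Hence the coloring induces the same partition as the \<open>i\<close>-th coordinate.
\<close>

section \<open>Two one-parameter families of vertices and the triples built from them\<close>

definition U_vert :: "nat \<Rightarrow> (nat \<Rightarrow> nat) \<Rightarrow> nat \<Rightarrow> nat list" where
  "U_vert s n j = map (\<lambda>p. min j (n p)) [1..<s + 1]"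

definition V_vert :: "nat \<Rightarrow> (nat \<Rightarrow> nat) \<Rightarrow> nat \<Rightarrow> nat list" where
  "V_vert s n j = map (\<lambda>p. if j < n p then j else 1) [1..<s + 1]"

definition U_edge :: "nat \<Rightarrow> (nat \<Rightarrow> nat) \<Rightarrow> nat \<Rightarrow> nat list set" where
  "U_edge s n j = {V_vert s n j, U_vert s n j, U_vert s n (j + 1)}"

text \<open>The conditional absorbs the exceptional triple at the bottom of each level. At
  \<open>j = n t\<close>, keeping \<open>V (j - 1)\<close> would give the \<open>t\<close>-th
  coordinate the values \<open>n t\<close>, \<open>1\<close> and \<open>n t - 1\<close> on the
  triple. These are pairwise distinct when \<open>n t > 2\<close>, so this coordinate would no
  longer be a proper coloring.\<close>

definition V_edge :: "nat \<Rightarrow> (nat \<Rightarrow> nat) \<Rightarrow> nat \<Rightarrow> nat list set" where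
  "V_edge s n j =
     {U_vert s n j, V_vert s n j, V_vert s n (if j \<in> n ` {1..s} then 1 else j - 1)}"

lemma length_U_vert [simp]: "length (U_vert s n j) = s"
  by (simp add: U_vert_def)

lemma length_V_vert [simp]: "length (V_vert s n j) = s"
  by (simp add: V_vert_def)

lemma nth_U_vert: "i < s \<Longrightarrow> U_vert s n j ! i = min j (n (Suc i))"
  by (simp add: U_vert_def del: upt_Suc)

lemma nth_V_vert: "i < s \<Longrightarrow> V_vert s n j ! i = (if j < n (Suc i) then j else 1)"
  by (simp add: V_vert_def del: upt_Suc)

section \<open>Order properties of the decreasing sequence\<close>

locale decreasing_values =
  fixes s :: nat and n :: "nat \<Rightarrow> nat"
  assumes s_pos: "1 \<le> s"
    and n_last: "2 \<le> n s"
    and n_step: "\<forall>t\<in>{1..<s}. n (t + 1) < n t"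
begin

abbreviation "U \<equiv> U_vert s n"
abbreviation "V \<equiv> V_vert s n"

lemma n_less:
  assumes "1 \<le> p" "p < q" "q \<le> s"
  shows "n q < n p"
  using assms(2,3)
proof (induction q rule: less_induct)
  case (less q)
  then obtain r where r: "q = Suc r" by (cases q) auto
  have "n q < n r" using n_step less.prems assms(1) r by auto
  moreover have "p = r \<or> n r < n p" using less r by (cases "p = r") auto
  ultimately show ?case by auto
qed

lemma n_le: "1 \<le> p \<Longrightarrow> p \<le> q \<Longrightarrow> q \<le> s \<Longrightarrow> n q \<le> n p"
  using n_less[of p q] by (cases "p = q") auto

lemma n_ge_last: "1 \<le> p \<Longrightarrow> p \<le> s \<Longrightarrow> n s \<le> n p"
  using n_le by auto

lemma n_ge_2: "1 \<le> p \<Longrightarrow> p \<le> s \<Longrightarrow> 2 \<le> n p"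
  using n_ge_last n_last le_trans by blast

lemma n_le_first: "1 \<le> p \<Longrightarrow> p \<le> s \<Longrightarrow> n p \<le> n 1"
  using n_le by auto

lemma inj_on_n: "inj_on n {1..s}"
  by (rule linorder_inj_onI) (use n_less in force)+

section \<open>Vertices and C-edges in terms of the two families\<close>

lemma u_vert_eq:
  assumes "2 \<le> t" "t \<le> s" "n t \<le> j" "j \<le> n (t - 1)"
  shows "u_vert s n t j = U j"
proof (rule nth_equalityI)
  fix i assume "i < length (u_vert s n t j)"
  then have i: "i < s" using assms by (simp add: u_vert_def)
  show "u_vert s n t j ! i = U j ! i"
  proof (cases "i < t - 1")
    case True
    with assms have "n (t - 1) \<le> n (Suc i)" by (intro n_le) auto
    with assms True i show ?thesis by (simp add: u_vert_def nth_U_vert nth_append)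
  next
    case False
    with assms i have "n (Suc i) \<le> n t" by (intro n_le) auto
    moreover have "t + (i - (t - 1)) = Suc i" using False assms by auto
    ultimately show ?thesis using assms False i
      by (simp add: u_vert_def nth_U_vert nth_append del: upt_Suc)
  qed
qed (use assms in \<open>simp add: u_vert_def\<close>)

text \<open>Unlike in \<open>u_vert_eq\<close>, the end \<open>j = n (t - 1)\<close> is excluded:
  there coordinate \<open>t - 1\<close> of \<open>V j\<close> has already dropped to
  \<open>1\<close>. For \<open>u_vert\<close> that end is needed as the successor in the topmost
  triple of a level.\<close>

lemma v_vert_eq:
  assumes "2 \<le> t" "t \<le> s" "n t \<le> j" "j < n (t - 1)"
  shows "v_vert s t j = V j"
proof (rule nth_equalityI)
  fix i assume "i < length (v_vert s t j)"
  then have i: "i < s" using assms by (simp add: v_vert_def)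
  show "v_vert s t j ! i = V j ! i"
  proof (cases "i < t - 1")
    case True
    with assms have "n (t - 1) \<le> n (Suc i)" by (intro n_le) auto
    with assms True i show ?thesis by (simp add: v_vert_def nth_V_vert nth_append)
  next
    case False
    with assms i have "n (Suc i) \<le> n t" by (intro n_le) auto
    with assms False i show ?thesis by (simp add: v_vert_def nth_V_vert nth_append)
  qed
qed (use assms in \<open>simp add: v_vert_def\<close>)

lemma replicate_eq_U: "j \<le> n s \<Longrightarrow> replicate s j = U j"
proof (rule nth_equalityI)
  fix i assume "j \<le> n s" "i < length (replicate s j)"
  then show "replicate s j ! i = U j ! i" using n_ge_last[of "Suc i"] by (simp add: nth_U_vert)
qed simp

lemma replicate_eq_V: "j < n s \<Longrightarrow> replicate s j = V j"
proof (rule nth_equalityI)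
  fix i assume "j < n s" "i < length (replicate s j)"
  then show "replicate s j ! i = V j ! i" using n_ge_last[of "Suc i"] by (simp add: nth_V_vert)
qed simp

lemma U_eq_V: "j < n s \<Longrightarrow> U j = V j"
  using replicate_eq_U replicate_eq_V by force

lemma map_n_eq_U: "map n [1..<s + 1] = U (n 1)"
  unfolding U_vert_def using n_le_first by auto

text \<open>No coordinate bound exceeds \<open>n 1\<close>, so every coordinate falls back to
  \<open>1\<close>. This lets both families share the index range \<open>{1..n 1}\<close> without
  adding a vertex.\<close>

lemma V_first: "V (n 1) = V 1"
proof (rule nth_equalityI)
  fix i assume "i < length (V (n 1))"
  then show "V (n 1) ! i = V 1 ! i" using n_le_first[of "Suc i"] by (simp add: nth_V_vert)
qed simp

lemma replicate_1: "replicate s 1 = V 1"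
  using n_last by (intro replicate_eq_V) auto

text \<open>The intervals \<open>{n t..<n (t - 1)}\<close> tile \<open>{n s..<n 1}\<close>; the
  level of \<open>j\<close> is the least \<open>t\<close> with \<open>n t \<le> j\<close>.\<close>

lemma level_exists:
  assumes "n s \<le> j" "j < n 1"
  obtains t where "2 \<le> t" "t \<le> s" "n t \<le> j" "j < n (t - 1)"
proof -
  define t where "t = (LEAST t. 1 \<le> t \<and> n t \<le> j)"
  have t: "1 \<le> t \<and> n t \<le> j" unfolding t_def
    by (rule LeastI[of _ s]) (use assms s_pos in auto)
  have "t \<le> s" unfolding t_def by (rule Least_le) (use assms s_pos in auto)
  moreover have "t \<noteq> 1" using t assms by auto
  moreover have "\<not> (1 \<le> t - 1 \<and> n (t - 1) \<le> j)"
    unfolding t_def by (rule not_less_Least) (use t calculation in \<open>auto simp: t_def\<close>)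
  ultimately show ?thesis using t that[of t] by force
qed

lemma X_set_eq: "X_set s n = U ` {1..n 1} \<union> V ` {1..n 1}"
proof
  show "X_set s n \<subseteq> U ` {1..n 1} \<union> V ` {1..n 1}"
  proof
    fix x assume "x \<in> X_set s n"
    then consider "x = map n [1..<s + 1]" | i where "x = replicate s i" "1 \<le> i" "i \<le> n s - 1"
      | t j where "2 \<le> t" "t \<le> s" "n t \<le> j" "j \<le> n (t - 1) - 1"
          "x = u_vert s n t j \<or> x = v_vert s t j"
      unfolding X_set_def by auto
    then show "x \<in> U ` {1..n 1} \<union> V ` {1..n 1}"
    proof cases
      case 1
      then show ?thesis using n_ge_2[of 1] s_pos map_n_eq_U by auto
    next
      case 2
      then show ?thesis using n_le_first[of s] s_pos replicate_eq_U[of i] by auto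
    next
      case 3
      have "2 \<le> n (t - 1)" by (rule n_ge_2) (use 3 in auto)
      then have j: "j < n (t - 1)" using 3 by auto
      moreover have "n (t - 1) \<le> n 1" "2 \<le> n t" using 3 by (auto intro: n_le n_ge_2)
      ultimately show ?thesis using 3 u_vert_eq[of t j] v_vert_eq[of t j] by auto
    qed
  qed
next
  have "U j \<in> X_set s n \<and> V j \<in> X_set s n" if j: "1 \<le> j" "j \<le> n 1" for j
  proof -
    have d: "U i \<in> X_set s n" if "1 \<le> i" "i < n s" for i
      using that replicate_eq_U[of i] unfolding X_set_def by force
    consider "j < n s" | "n s \<le> j" "j < n 1" | "j = n 1" using j by linarith
    then show ?thesis
    proof cases
      case 1
      then have "U j \<in> X_set s n" using d j by blast
      then show ?thesis using U_eq_V[OF 1] by simp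
    next
      case 2
      then obtain t where t: "2 \<le> t" "t \<le> s" "n t \<le> j" "j < n (t - 1)" by (rule level_exists)
      then have "t \<in> {2..s}" "j \<in> {n t..n (t - 1) - 1}" by auto
      then have "u_vert s n t j \<in> X_set s n \<and> v_vert s t j \<in> X_set s n"
        unfolding X_set_def by blast
      then show ?thesis using t by (simp add: u_vert_eq v_vert_eq)
    next
      case 3
      have "U j \<in> X_set s n" using 3 map_n_eq_U unfolding X_set_def by simp
      moreover have "V j \<in> X_set s n" using 3 V_first d[of 1] U_eq_V[of 1] n_last by auto
      ultimately show ?thesis by simp
    qed
  qed
  then show "U ` {1..n 1} \<union> V ` {1..n 1} \<subseteq> X_set s n" by auto
qed

text \<open>Resolves the conditional in \<open>V_edge\<close> inside one level: values of earlier
  indices lie above the level, those of later indices below it.\<close>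

lemma value_in_level:
  assumes "2 \<le> t" "t \<le> s" "n t \<le> j" "j < n (t - 1)"
  shows "j \<in> n ` {1..s} \<longleftrightarrow> j = n t"
proof
  assume "j \<in> n ` {1..s}"
  then obtain p where p: "1 \<le> p" "p \<le> s" "j = n p" by auto
  have "n (t - 1) \<le> n p" if "p < t" by (rule n_le) (use that assms p in auto)
  then have "\<not> p < t" using assms p by auto
  moreover have "n p < n t" if "t < p" by (rule n_less) (use that assms p in auto)
  then have "\<not> t < p" using assms p by auto
  ultimately show "j = n t" using p by auto
qed (use assms in auto)

lemma C_star_eq: "C_star s n = U_edge s n ` {n s..<n 1} \<union> V_edge s n ` {n s..<n 1}"
proof
  show "C_star s n \<subseteq> U_edge s n ` {n s..<n 1} \<union> V_edge s n ` {n s..<n 1}"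
  proof
    fix e assume "e \<in> C_star s n"
    then obtain t where t: "2 \<le> t" "t \<le> s" and
      "(\<exists>j. n t + 1 \<le> j \<and> j \<le> n (t - 1) - 1 \<and>
          e = {u_vert s n t j, v_vert s t j, v_vert s t (j - 1)}) \<or>
       (\<exists>j. n t \<le> j \<and> j \<le> n (t - 1) - 1 \<and>
          e = {v_vert s t j, u_vert s n t j, u_vert s n t (j + 1)}) \<or>
       e = {u_vert s n t (n t), v_vert s t (n t), replicate s 1}"
      unfolding C_star_def Bex_def UN_iff Un_iff mem_Collect_eq atLeastAtMost_iff insert_iff empty_iff
      by blast
    then consider
        j where "n t + 1 \<le> j" "j \<le> n (t - 1) - 1"
          "e = {u_vert s n t j, v_vert s t j, v_vert s t (j - 1)}"
      | j where "n t \<le> j" "j \<le> n (t - 1) - 1"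
          "e = {v_vert s t j, u_vert s n t j, u_vert s n t (j + 1)}"
      | "e = {u_vert s n t (n t), v_vert s t (n t), replicate s 1}"
      by blast
    note cs = this
    have le: "n (t - 1) \<le> n 1" "2 \<le> n (t - 1)" "n s \<le> n t" "n t < n (t - 1)"
      using t by (auto intro: n_le n_ge_2 n_less)
    from cs show "e \<in> U_edge s n ` {n s..<n 1} \<union> V_edge s n ` {n s..<n 1}"
    proof cases
      case 1
      then have "e = V_edge s n j"
        using t le value_in_level[of t j] by (simp add: V_edge_def u_vert_eq v_vert_eq)
      then show ?thesis using 1 le by auto
    next
      case 2
      then have "e = U_edge s n j" using t le by (simp add: U_edge_def u_vert_eq v_vert_eq)
      then show ?thesis using 2 le by auto
    next
      case 3
      then have "e = V_edge s n (n t)"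
        using t le replicate_1 by (simp add: V_edge_def u_vert_eq v_vert_eq)
      then show ?thesis using le by auto
    qed
  qed
next
  have "U_edge s n j \<in> C_star s n \<and> V_edge s n j \<in> C_star s n" if j: "n s \<le> j" "j < n 1" for j
  proof -
    obtain t where t: "2 \<le> t" "t \<le> s" "n t \<le> j" "j < n (t - 1)" using j by (rule level_exists)
    have t': "t \<in> {2..s}" "j \<in> {n t..n (t - 1) - 1}" using t by auto
    have "U_edge s n j = {v_vert s t j, u_vert s n t j, u_vert s n t (j + 1)}"
      using t by (simp add: U_edge_def u_vert_eq v_vert_eq)
    then have "U_edge s n j \<in> C_star s n" unfolding C_star_def using t' by blast
    moreover have "V_edge s n j \<in> C_star s n"
    proof (cases "j = n t")
      case True
      then have "V_edge s n j = {u_vert s n t (n t), v_vert s t (n t), replicate s 1}"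
        using t replicate_1 by (simp add: V_edge_def u_vert_eq v_vert_eq)
      then show ?thesis unfolding C_star_def using t' by blast
    next
      case False
      then have "V_edge s n j = {u_vert s n t j, v_vert s t j, v_vert s t (j - 1)}"
        using t value_in_level[of t j] by (simp add: V_edge_def u_vert_eq v_vert_eq)
      moreover have "j \<in> {n t + 1..n (t - 1) - 1}" using t False by auto
      ultimately show ?thesis unfolding C_star_def using t' by blast
    qed
    ultimately show ?thesis ..
  qed
  then show "U_edge s n ` {n s..<n 1} \<union> V_edge s n ` {n s..<n 1} \<subseteq> C_star s n" by auto
qed

section \<open>Counting the C-edges\<close>

lemma U_last: "n s \<le> j \<Longrightarrow> U j ! (s - 1) = n s"
  using s_pos by (simp add: nth_U_vert)

lemma V_last: "n s \<le> j \<or> j = 1 \<Longrightarrow> V j ! (s - 1) = 1"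
  using s_pos by (auto simp: nth_V_vert)

lemma U_0: "j \<le> n 1 \<Longrightarrow> U j ! 0 = j"
  using s_pos by (simp add: nth_U_vert)

lemma V_0: "j < n 1 \<Longrightarrow> V j ! 0 = j"
  using s_pos by (simp add: nth_V_vert)

lemma predecessor_V_last:
  assumes "n s \<le> j"
  shows "V (if j \<in> n ` {1..s} then 1 else j - 1) ! (s - 1) = 1"
proof (rule V_last, cases "j \<in> n ` {1..s}")
  case False
  \<comment> \<open>As \<open>n s\<close> is itself a value, the branch \<open>j - 1\<close> occurs
    only for \<open>n s < j\<close>, so \<open>j - 1\<close> is still at least
    \<open>n s\<close>.\<close>
  then have "j \<noteq> n s" using s_pos by auto
  with assms False show "n s \<le> (if j \<in> n ` {1..s} then 1 else j - 1) \<or>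
      (if j \<in> n ` {1..s} then 1 else j - 1) = 1" by auto
qed auto

text \<open>For indices from \<open>n s\<close> on, the last coordinate is \<open>n s\<close> on
  \<open>U\<close> and \<open>1\<close> on \<open>V\<close>, so it separates the two families inside
  an edge.\<close>

lemma U_edge_filter: "n s \<le> j \<Longrightarrow> {x \<in> U_edge s n j. x ! (s - 1) = 1} = {V j}"
  using U_last[of j] U_last[of "j + 1"] V_last[of j] n_last by (auto simp: U_edge_def)

lemma U_edge_filter_not:
  "n s \<le> j \<Longrightarrow> {x \<in> U_edge s n j. x ! (s - 1) \<noteq> 1} = {U j, U (j + 1)}"
  using U_last[of j] U_last[of "j + 1"] V_last[of j] n_last by (auto simp: U_edge_def)

lemma V_edge_filter_not: "n s \<le> j \<Longrightarrow> {x \<in> V_edge s n j. x ! (s - 1) \<noteq> 1} = {U j}"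
  using U_last[of j] V_last[of j] predecessor_V_last[of j] n_last unfolding V_edge_def by force

text \<open>A \<open>U_edge\<close> is recovered from its only \<open>V\<close>-vertex and a
  \<open>V_edge\<close> from its only \<open>U\<close>-vertex, the index being the first coordinate.
  The two kinds are disjoint because they contain two and one \<open>U\<close>-vertices
  respectively.\<close>

lemma card_C_star: "card (C_star s n) = 2 * n 1 - 2 * n s"
proof -
  let ?J = "{n s..<n 1}"
  have "inj_on (U_edge s n) ?J"
  proof (rule inj_onI)
    fix j k assume *: "j \<in> ?J" "k \<in> ?J" "U_edge s n j = U_edge s n k"
    then have "V j = V k" using U_edge_filter[of j] U_edge_filter[of k] by auto
    then have "V j ! 0 = V k ! 0" by (rule arg_cong)
    then show "j = k" using V_0[of j] V_0[of k] *(1,2) by simp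
  qed
  moreover have "inj_on (V_edge s n) ?J"
  proof (rule inj_onI)
    fix j k assume *: "j \<in> ?J" "k \<in> ?J" "V_edge s n j = V_edge s n k"
    then have "U j = U k" using V_edge_filter_not[of j] V_edge_filter_not[of k] by auto
    then have "U j ! 0 = U k ! 0" by (rule arg_cong)
    then show "j = k" using U_0[of j] U_0[of k] *(1,2) by simp
  qed
  moreover have "U_edge s n ` ?J \<inter> V_edge s n ` ?J = {}"
  proof -
    have False if *: "j \<in> ?J" "k \<in> ?J" "U_edge s n j = V_edge s n k" for j k
    proof -
      have "{U j, U (j + 1)} = {U k}"
        using U_edge_filter_not[of j] V_edge_filter_not[of k] * by auto
      then have "U j ! 0 = U (j + 1) ! 0" by auto
      then show False using U_0[of j] U_0[of "j + 1"] *(1) by simp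
    qed
    then show ?thesis by blast
  qed
  ultimately have "card (C_star s n) = card ?J + card ?J"
    unfolding C_star_eq by (simp add: card_Un_disjoint card_image)
  then show ?thesis by simp
qed

section \<open>Each coordinate is a strict coloring\<close>

abbreviation "H \<equiv> H_star s n"

lemma U_in_X: "1 \<le> j \<Longrightarrow> j \<le> n 1 \<Longrightarrow> U j \<in> X_set s n"
  and V_in_X: "1 \<le> j \<Longrightarrow> j \<le> n 1 \<Longrightarrow> V j \<in> X_set s n"
  unfolding X_set_eq by auto

lemma is_mixed_hypergraph_H: "is_mixed_hypergraph H"
proof -
  have X: "U j \<in> X_set s n" "U (j + 1) \<in> X_set s n" "V j \<in> X_set s n" "V 1 \<in> X_set s n"
    "V (j - 1) \<in> X_set s n" if "n s \<le> j" "j < n 1" for j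
    using that n_last by (auto intro!: U_in_X V_in_X)
  have "C_star s n \<subseteq> Pow (X_set s n)"
    unfolding C_star_eq U_edge_def V_edge_def using X by auto
  moreover have "finite (X_set s n)" unfolding X_set_eq by simp
  ultimately show ?thesis
    unfolding is_mixed_hypergraph_def H_star_def D_set_def by auto
qed

text \<open>In coordinate \<open>p\<close>, \<open>V j\<close> has either \<open>j < n p\<close>,
  which differs from both \<open>k\<close> and \<open>n p\<close>, or \<open>1\<close>, which is
  smaller than both.\<close>

lemma V_U_D_edge:
  assumes "1 \<le> j" "j \<le> n 1" "2 \<le> k" "k \<le> n 1" "j \<noteq> k"
  shows "{V j, U k} \<in> D_set s n"
proof -
  have "V j ! i \<noteq> U k ! i" if "i < s" for i
    using that assms n_ge_2[of "Suc i"] by (auto simp: nth_V_vert nth_U_vert min_def)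
  then show ?thesis unfolding D_set_def using assms U_in_X[of k] V_in_X[of j] by auto
qed

text \<open>D-edges differ in every coordinate by construction. In a C-edge of index
  \<open>j\<close>, the \<open>i\<close>-th coordinate identifies \<open>U j\<close> with
  \<open>V j\<close> if \<open>j < n i\<close>; otherwise \<open>U j\<close> with
  \<open>U (j + 1)\<close>, or \<open>V j\<close> with its predecessor.\<close>

lemma coordinate_proper:
  assumes i: "1 \<le> i" "i \<le> s"
  shows "proper_coloring H (n i) (\<lambda>x. x ! (i - 1))"
proof -
  have U: "U j ! (i - 1) = min j (n i)" for j using i by (simp add: nth_U_vert)
  have V: "V j ! (i - 1) = (if j < n i then j else 1)" for j using i by (simp add: nth_V_vert)
  have ni: "2 \<le> n i" using i by (rule n_ge_2)
  have "\<exists>x\<in>U_edge s n j. \<exists>y\<in>U_edge s n j. x \<noteq> y \<and> x ! (i - 1) = y ! (i - 1)"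
    if j: "n s \<le> j" "j < n 1" for j
  proof (cases "j < n i")
    case True
    moreover have "U j \<noteq> V j" using U_last[of j] V_last[of j] j n_last by auto
    ultimately show ?thesis unfolding U_edge_def using U[of j] V[of j] by auto
  next
    case False
    moreover have "U j \<noteq> U (j + 1)" using U_0[of j] U_0[of "j + 1"] j by auto
    ultimately show ?thesis unfolding U_edge_def using U[of j] U[of "j + 1"] by auto
  qed
  moreover have "\<exists>x\<in>V_edge s n j. \<exists>y\<in>V_edge s n j. x \<noteq> y \<and> x ! (i - 1) = y ! (i - 1)"
    if j: "n s \<le> j" "j < n 1" for j
  proof (cases "j < n i")
    case True
    moreover have "U j \<noteq> V j" using U_last[of j] V_last[of j] j n_last by auto
    ultimately show ?thesis unfolding V_edge_def using U[of j] V[of j] by auto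
  next
    case False
    define k where "k = (if j \<in> n ` {1..s} then 1 else j - 1)"
    have k: "k < j" using j n_last by (auto simp: k_def)
    have "V j \<noteq> V k" using V_0[of j] V_0[of k] j k by auto
    \<comment> \<open>If \<open>j\<close> is not a value, then \<open>j \<noteq> n i\<close>, so
      \<open>n i \<le> j - 1\<close>. Either way \<open>V k\<close> has \<open>i\<close>-th
      coordinate \<open>1\<close>, as does \<open>V j\<close>.\<close>
    moreover have "k = 1 \<or> n i \<le> k" using False i by (force simp: k_def)
    moreover from this have "V j ! (i - 1) = V k ! (i - 1)" using False V[of j] V[of k] by auto
    ultimately show ?thesis unfolding V_edge_def k_def[symmetric] by blast
  qed
  moreover have "\<exists>x\<in>e. \<exists>y\<in>e. x ! (i - 1) \<noteq> y ! (i - 1)" if e: "e \<in> D_set s n" for e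
  proof -
    obtain x y where "e = {x, y}" "\<forall>i<s. x ! i \<noteq> y ! i" using e unfolding D_set_def by auto
    then show ?thesis using i by auto
  qed
  moreover have "x ! (i - 1) \<in> {1..n i}" if "x \<in> X_set s n" for x
    using that ni U V unfolding X_set_eq by auto
  ultimately show ?thesis
    unfolding proper_coloring_def H_star_def by (auto simp: C_star_eq)
qed

lemma coordinate_strict:
  assumes i: "1 \<le> i" "i \<le> s"
  shows "strict_coloring H (n i) (\<lambda>x. x ! (i - 1))"
proof -
  have "{1..n i} \<subseteq> (\<lambda>x. x ! (i - 1)) ` X_set s n"
  proof
    fix j assume j: "j \<in> {1..n i}"
    then have "U j \<in> X_set s n" using n_le_first[OF i] by (intro U_in_X) auto
    moreover have "U j ! (i - 1) = j" using i j by (simp add: nth_U_vert)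
    ultimately show "j \<in> (\<lambda>x. x ! (i - 1)) ` X_set s n" by force
  qed
  then show ?thesis using coordinate_proper[OF i]
    unfolding strict_coloring_def proper_coloring_def by (auto simp: H_star_def)
qed

section \<open>Every proper coloring is a coordinate up to renaming colors\<close>

lemma proper_coloring_coordinate:
  assumes c: "proper_coloring H k c"
  obtains i where "1 \<le> i" "i \<le> s"
    "\<And>x. x \<in> X_set s n \<Longrightarrow> c x = c (U (x ! (i - 1)))" "inj_on (\<lambda>j. c (U j)) {1..n i}"
proof -
  have D: "c (V j) \<noteq> c (U k)" if "1 \<le> j" "j \<le> n 1" "2 \<le> k" "k \<le> n 1" "j \<noteq> k" for j k
    using V_U_D_edge[OF that] c unfolding proper_coloring_def H_star_def by fastforce
  have C: "\<exists>x\<in>e. \<exists>y\<in>e. x \<noteq> y \<and> c x = c y" if "e \<in> C_star s n" for e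
    using that c unfolding proper_coloring_def H_star_def by auto
  have CU: "c (U j) = c (V j) \<or> c (U j) = c (U (j + 1))" if j: "n s \<le> j" "j < n 1" for j
  proof -
    \<comment> \<open>\<open>V j\<close> and \<open>U (j + 1)\<close> form a D-edge, so they are not
      the equally colored pair.\<close>
    have "U_edge s n j \<in> C_star s n" using j unfolding C_star_eq by auto
    then show ?thesis using C[of "U_edge s n j"] D[of j "j + 1"] j n_last
      unfolding U_edge_def by auto
  qed
  have CV: "c (U j) = c (V j) \<or> c (V j) = c (V (if j \<in> n ` {1..s} then 1 else j - 1))"
    if j: "n s \<le> j" "j < n 1" for j
  proof -
    define l where "l = (if j \<in> n ` {1..s} then 1 else j - 1)"
    have l: "1 \<le> l" "l < j" using j n_last by (auto simp: l_def)
    \<comment> \<open>Here the pair ruled out by a D-edge is \<open>V l\<close> and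
      \<open>U j\<close>.\<close>
    have "V_edge s n j \<in> C_star s n" using j unfolding C_star_eq by auto
    then show ?thesis using C[of "V_edge s n j"] D[of l j] l j n_last
      unfolding V_edge_def l_def[symmetric] by auto
  qed
  have n1: "2 \<le> n 1" using s_pos by (intro n_ge_2) auto
  define m where "m = (LEAST j. 1 \<le> j \<and> j \<le> n 1 \<and> c (U j) \<noteq> c (V j))"
  \<comment> \<open>A candidate for the minimum exists: \<open>V (n 1)\<close> is
    \<open>V 1\<close>, which forms a D-edge with \<open>U (n 1)\<close>.\<close>
  have "1 \<le> n 1 \<and> n 1 \<le> n 1 \<and> c (U (n 1)) \<noteq> c (V (n 1))"
    using D[of 1 "n 1"] n1 V_first by auto
  then have m: "1 \<le> m \<and> m \<le> n 1 \<and> c (U m) \<noteq> c (V m)" unfolding m_def by (rule LeastI)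
  have below: "c (U j) = c (V j)" if "1 \<le> j" "j < m" for j
    using not_less_Least[of j "\<lambda>j. 1 \<le> j \<and> j \<le> n 1 \<and> c (U j) \<noteq> c (V j)"] that m
    unfolding m_def by auto
  have ms: "n s \<le> m" using m U_eq_V[of m] by (cases "m < n s") auto
  have special: "m \<in> n ` {1..s}"
  proof (rule ccontr)
    assume ns: "m \<notin> n ` {1..s}"
    then have "m \<noteq> n s" "m \<noteq> n 1" using s_pos by auto
    then have *: "n s < m" "m < n 1" using ms m by auto
    \<comment> \<open>If \<open>m\<close> were no value, minimality would pass the color of
      \<open>U (m - 1)\<close> through \<open>V (m - 1)\<close> to \<open>V m\<close>, against a
      D-edge; this edge needs \<open>2 \<le> m - 1\<close>, which holds since
      \<open>n s < m\<close>.\<close>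
    then have "c (V m) = c (V (m - 1))" using CV[of m] m ns by auto
    also have "\<dots> = c (U (m - 1))" using below[of "m - 1"] * n_last by auto
    finally have "c (V m) = c (U (m - 1))" .
    moreover have "c (V m) \<noteq> c (U (m - 1))" by (rule D) (use * n_last in auto)
    ultimately show False by simp
  qed
  then obtain i where i: "1 \<le> i" "i \<le> s" "m = n i" by auto
  have m2: "2 \<le> m" using ms n_last by auto
  have above: "c (V j) = c (V 1) \<and> c (U j) = c (U m)" if "m \<le> j" "j \<le> n 1" for j
    using that
  proof (induction j rule: dec_induct)
    case base
    show ?case
    proof (cases "m = n 1")
      case False
      then show ?thesis using CV[of m] m ms special by auto
    qed (use V_first in simp)
  next
    case (step j)
    then have IH: "c (V j) = c (V 1)" "c (U j) = c (U m)" by auto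
    \<comment> \<open>\<open>V j\<close> has the color of \<open>V 1\<close>, which forms a D-edge
      with \<open>U j\<close>; so the \<open>U_edge\<close> must pass the color on to
      \<open>U (j + 1)\<close>.\<close>
    have "c (U j) \<noteq> c (V j)" using D[of 1 j] IH step m2 by auto
    then have U: "c (U (Suc j)) = c (U m)" using CU[of j] step ms IH by auto
    have "c (V (Suc j)) = c (V 1)"
    proof (cases "Suc j = n 1")
      case False
      \<comment> \<open>\<open>U (Suc j)\<close> has the color of \<open>U m\<close>, so
        \<open>V (Suc j)\<close> must agree with its predecessor. That is \<open>V 1\<close> or
        \<open>V j\<close>, and both have the color of \<open>V 1\<close>.\<close>
      have "c (V (Suc j)) \<noteq> c (U m)" using D[of "Suc j" m] step m2 by auto
      then show ?thesis using CV[of "Suc j"] U IH step ms False by (auto split: if_splits)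
    qed (use V_first in simp)
    with U show ?case by simp
  qed
  \<comment> \<open>The vertices \<open>U 1\<close>, ..., \<open>U m\<close> represent the color
    classes. From \<open>m\<close> on, every \<open>V j\<close> belongs to the class of
    \<open>U 1\<close>, because \<open>V 1\<close> and \<open>U 1\<close> agree in color.\<close>
  have "c x = c (U (x ! (i - 1)))" if "x \<in> X_set s n" for x
  proof -
    obtain j where j: "1 \<le> j" "j \<le> n 1" "x = U j \<or> x = V j" using \<open>x \<in> X_set s n\<close>
      unfolding X_set_eq by auto
    have "U j ! (i - 1) = min j m" "V j ! (i - 1) = (if j < m then j else 1)"
      using i by (simp_all add: nth_U_vert nth_V_vert)
    then show ?thesis using j above[of j] below[of j] below[of 1] m2
      by (cases "j < m") (auto simp: min_def)
  qed
  moreover have "inj_on (\<lambda>j. c (U j)) {1..n i}"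
  proof (rule linorder_inj_onI)
    fix j k assume "j < k" "j \<in> {1..n i}" "k \<in> {1..n i}"
    then show "c (U j) \<noteq> c (U k)" using D[of j k] below[of j] i m by auto
  qed auto
  ultimately show ?thesis using i that by blast
qed

section \<open>Comparison of partitions and the conclusion\<close>

lemma color_classes_cong:
  assumes "\<And>x y. x \<in> vertices G \<Longrightarrow> y \<in> vertices G \<Longrightarrow> c x = c y \<longleftrightarrow> d x = d y"
  shows "color_classes G c = color_classes G d"
proof -
  \<comment> \<open>Describing each class by one of its vertices removes the color names, so only
    equality of colors matters.\<close>
  have "color_classes G f = (\<lambda>y. {x \<in> vertices G. f x = f y}) ` vertices G" for f
    unfolding color_classes_def by auto
  then show ?thesis using assms by (auto intro!: image_cong)
qed

lemma strict_coloring_coordinate: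
  assumes c: "strict_coloring H k c"
  obtains i where "1 \<le> i" "i \<le> s" "k = n i"
    "color_classes H c = color_classes H (\<lambda>x. x ! (i - 1))"
proof -
  have "proper_coloring H k c" using c by (simp add: strict_coloring_def)
  then obtain i where i: "1 \<le> i" "i \<le> s"
    and rep: "\<And>x. x \<in> X_set s n \<Longrightarrow> c x = c (U (x ! (i - 1)))"
    and inj: "inj_on (\<lambda>j. c (U j)) {1..n i}"
    using proper_coloring_coordinate by blast
  have im: "(\<lambda>x. x ! (i - 1)) ` X_set s n = {1..n i}"
    using coordinate_strict[OF i] by (simp add: strict_coloring_def H_star_def)
  have "c ` X_set s n = (\<lambda>j. c (U j)) ` (\<lambda>x. x ! (i - 1)) ` X_set s n"
    unfolding image_image using rep by (rule image_cong[OF refl])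
  \<comment> \<open>Strictness makes \<open>k\<close> the number of colors in use, and the
    representatives show that this number is \<open>n i\<close>.\<close>
  then have "card (c ` X_set s n) = n i" using inj im by (simp only: card_image) simp
  then have "k = n i" using c by (simp add: strict_coloring_def H_star_def)
  moreover have "color_classes H c = color_classes H (\<lambda>x. x ! (i - 1))"
  proof (rule color_classes_cong)
    fix x y assume "x \<in> vertices H" "y \<in> vertices H"
    then have xy: "x \<in> X_set s n" "y \<in> X_set s n" by (simp_all add: H_star_def)
    then have "x ! (i - 1) \<in> {1..n i}" "y ! (i - 1) \<in> {1..n i}" using im by auto
    then show "c x = c y \<longleftrightarrow> x ! (i - 1) = y ! (i - 1)"
      using rep[OF xy(1)] rep[OF xy(2)] inj_on_eq_iff[OF inj] by simp
  qed
  ultimately show ?thesis using i that by blast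
qed

lemma one_realization_H: "one_realization H (n ` {1..s})"
proof -
  have "feasible_set H = n ` {1..s}"
    unfolding feasible_set_def using coordinate_strict strict_coloring_coordinate
    by (auto; metis atLeastAtMost_iff image_eqI)
  moreover have "num_strict_partitions H (n i) = 1" if i: "1 \<le> i" "i \<le> s" for i
  proof -
    have "color_classes H c = color_classes H (\<lambda>x. x ! (i - 1))"
      if "strict_coloring H (n i) c" for c
    proof -
      obtain l where "1 \<le> l" "l \<le> s" "n i = n l"
        "color_classes H c = color_classes H (\<lambda>x. x ! (l - 1))"
        using \<open>strict_coloring H (n i) c\<close> by (rule strict_coloring_coordinate)
      then show ?thesis using inj_onD[OF inj_on_n, of i l] i by auto
    qed
    then have "{color_classes H c | c. strict_coloring H (n i) c} =
        {color_classes H (\<lambda>x. x ! (i - 1))}"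
      using coordinate_strict[OF i] by blast
    then show ?thesis unfolding num_strict_partitions_def by simp
  qed
  ultimately show ?thesis unfolding one_realization_def using is_mixed_hypergraph_H by auto
qed

end

theorem theorem3p4:
  fixes s :: nat and n :: "nat \<Rightarrow> nat" and S :: "nat set"
  assumes "1 \<le> s"
    and "S = n ` {1..s}"
    and "2 \<le> n s"
    and "\<forall>t\<in>{1..<s}. n (t + 1) < n t"
  shows "card (c_edges (H_star s n)) = 2 * n 1 - 2 * n s \<and> one_realization (H_star s n) S"
proof -
  interpret decreasing_values s n using assms by unfold_locales
  show ?thesis using card_C_star one_realization_H assms(2) by (simp add: H_star_def)
qed

end
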